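(* There is a metrizable space $X$ with $|X| = \mathfrak{c}^{+(\omega+1)}$ such that $X$ is $2^\omega$-coverable but not $2^\omega$-partitionable.
   Context: $\mathfrak{c} = 2^{\aleph_0}$. Put $\mathfrak{c}^{+0} = \mathfrak{c}$, $\mathfrak{c}^{+(n+1)} = (\mathfrak{c}^{+n})^+$ (cardinal successor), $\mathfrak{c}^{+\omega} = \sup_{n<\omega} \mathfrak{c}^{+n}$, and $\mathfrak{c}^{+(\omega+1)} = (\mathfrak{c}^{+\omega})^+$. $2^\omega$ denotes the Cantor space. A space $X$ is $2^\omega$-partitionable if there is a partition of $X$ (a family of pairwise disjoint subsets with union $X$) each member of which, with the subspace topology, is homeomorphic to $2^\omega$. A space $X$ is $2^\omega$-coverable if there is a family of subsets of $X$ with union $X$, each member of which, with the subspace topology, is homeomorphic to $2^\omega$. *)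

theory Defs
  imports "HOL-Analysis.Analysis" "HOL-Library.Disjoint_Sets"
begin

unbundle cardinal_syntax

section \<open>The cardinals \<open>\<cc>\<^sup>+\<^sup>n\<close>, \<open>\<cc>\<^sup>+\<^sup>\<omega>\<close> and \<open>\<cc>\<^sup>+\<^sup>(\<^sup>\<omega>\<^sup>+\<^sup>1\<^sup>)\<close>\<close>

text \<open>
  HOL does not prove that some type has \<open>\<cc>\<^sup>+\<^sup>\<omega>\<close> many elements (there are models in which no type
  has), and \<^const>\<open>cardSuc\<close> raises the type from \<open>'a rel\<close> to \<open>'a set rel\<close>, so it cannot be iterated
  at one type. The cardinals are therefore given by predicates on relations over an arbitrary
  type \<open>'a\<close>; each determines its argument up to \<open>=o\<close>, as proved below.
\<close>

primrec is_c_plus :: "nat \<Rightarrow> 'a rel \<Rightarrow> bool" where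
  "is_c_plus 0 r \<longleftrightarrow> r =o ctwo ^c natLeq"
| "is_c_plus (Suc n) r \<longleftrightarrow> (\<exists>s :: 'a rel. is_c_plus n s \<and> r =o cardSuc s)"

text \<open>
  The supremum is taken among the cardinals on subsets of \<open>'a\<close>. This loses nothing, because every
  cardinal below \<open>r\<close> is represented there.
\<close>

definition is_c_plus_omega :: "'a rel \<Rightarrow> bool" where
  "is_c_plus_omega r \<longleftrightarrow>
     Card_order r \<and>
     (\<forall>n. \<exists>s :: 'a rel. is_c_plus n s \<and> s \<le>o r) \<and>
     (\<forall>t :: 'a rel. Card_order t \<and> (\<forall>n. \<exists>s :: 'a rel. is_c_plus n s \<and> s \<le>o t) \<longrightarrow> r \<le>o t)"

definition is_c_plus_omega_plus_1 :: "'a rel \<Rightarrow> bool" where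
  "is_c_plus_omega_plus_1 r \<longleftrightarrow> (\<exists>s :: 'a rel. is_c_plus_omega s \<and> r =o cardSuc s)"

lemma is_c_plus_Card_order: "is_c_plus n r \<Longrightarrow> Card_order r"
proof (induction n arbitrary: r)
  case 0
  then have "r =o ctwo ^c natLeq"
    by simp
  then show ?case
    by (rule Card_order_ordIso[OF Card_order_cexp])
next
  case (Suc n)
  then obtain s :: "'a rel" where s: "is_c_plus n s" "r =o cardSuc s"
    by auto
  show ?case
    by (rule Card_order_ordIso[OF cardSuc_Card_order[OF Suc.IH[OF s(1)]] s(2)])
qed

lemma is_c_plus_unique:
  fixes r :: "'a rel" and r' :: "'b rel"
  assumes "is_c_plus n r" "is_c_plus n r'"
  shows "r =o r'"
  using assms
proof (induction n arbitrary: r r')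
  case 0
  then have "r =o ctwo ^c natLeq" "r' =o ctwo ^c natLeq"
    by simp_all
  then show ?case
    by (rule ordIso_transitive[OF _ ordIso_symmetric])
next
  case (Suc n)
  then obtain s :: "'a rel" and s' :: "'b rel"
    where s: "is_c_plus n s" "r =o cardSuc s" and s': "is_c_plus n s'" "r' =o cardSuc s'"
    by auto
  have "cardSuc s =o cardSuc s'"
    using cardSuc_invar_ordIso[OF is_c_plus_Card_order[OF s(1)] is_c_plus_Card_order[OF s'(1)]]
      Suc.IH[OF s(1) s'(1)] by (rule iffD2)
  with s(2) have "r =o cardSuc s'"
    by (rule ordIso_transitive)
  then show ?case
    using ordIso_symmetric[OF s'(2)] by (rule ordIso_transitive)
qed

lemma is_c_plus_omega_unique:
  fixes r r' :: "'a rel"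
  assumes "is_c_plus_omega r" "is_c_plus_omega r'"
  shows "r =o r'"
proof -
  have "r \<le>o r'" "r' \<le>o r"
    using assms unfolding is_c_plus_omega_def by blast+
  then show ?thesis
    unfolding ordIso_iff_ordLeq by (rule conjI)
qed

lemma is_c_plus_omega_plus_1_unique:
  fixes r r' :: "'a rel"
  assumes "is_c_plus_omega_plus_1 r" "is_c_plus_omega_plus_1 r'"
  shows "r =o r'"
proof -
  obtain s s' :: "'a rel"
    where s: "is_c_plus_omega s" "r =o cardSuc s" and s': "is_c_plus_omega s'" "r' =o cardSuc s'"
    using assms unfolding is_c_plus_omega_plus_1_def by auto
  have "Card_order s" "Card_order s'"
    using s(1) s'(1) unfolding is_c_plus_omega_def by blast+
  from cardSuc_invar_ordIso[OF this] have "cardSuc s =o cardSuc s'"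
    using is_c_plus_omega_unique[OF s(1) s'(1)] by (rule iffD2)
  with s(2) have "r =o cardSuc s'"
    by (rule ordIso_transitive)
  then show ?thesis
    using ordIso_symmetric[OF s'(2)] by (rule ordIso_transitive)
qed

section \<open>Covering and partitioning by Cantor spaces\<close>

definition cantor_space :: "(nat \<Rightarrow> bool) topology" where
  "cantor_space = product_topology (\<lambda>_. discrete_topology UNIV) UNIV"

definition cantor_coverable :: "'a topology \<Rightarrow> bool" where
  "cantor_coverable X \<longleftrightarrow>
     (\<exists>\<C>. \<Union>\<C> = topspace X \<and>
          (\<forall>C\<in>\<C>. subtopology X C homeomorphic_space cantor_space))"

definition cantor_partitionable :: "'a topology \<Rightarrow> bool" where
  "cantor_partitionable X \<longleftrightarrow>
     (\<exists>\<C>. \<Union>\<C> = topspace X \<and> disjoint \<C> \<and>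
          (\<forall>C\<in>\<C>. subtopology X C homeomorphic_space cantor_space))"

end

(*
  Let \<lambda> be the cardinal whose successor is \<kappa>, so \<lambda> is the supremum of an increasing sequence of
  regular cardinals r(n). Diagonalising over \<lambda> many functions at a time gives a family of \<kappa> many
  functions f(\<alpha>) in the product of the r(n) which is strictly increasing modulo finite sets. The
  space X is the set Z of these branches together with a Cantor set attached to each of their
  finite initial segments, arranged so that a branch and the Cantor sets along it form a Cantor
  set; hence X is coverable.

  A Cantor set contained in Z would be well-ordered by a relation that is a countable union of
  closed sets. By the Baire category theorem every nonempty open subset U of it would contain
  nonempty open sets V and W with every point of V below every point of W; repeating this inside V
  gives an infinite descending sequence. So every member of a partition of X into Cantor sets meets
  X - Z, which has only \<lambda> many points. The partition then has at most \<lambda> members, each of size at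
  most \<lambda>, and cannot cover \<kappa> many points.
*)
theory Submission
  imports Defs
begin

section \<open>Sequence spaces and the Cantor space\<close>

abbreviation sequence_space :: "(nat \<Rightarrow> 'b) topology" where
  "sequence_space \<equiv> product_topology (\<lambda>_. discrete_topology UNIV) UNIV"

lemma metrizable_sequence_space: "metrizable_space sequence_space"
  by (simp add: metrizable_space_product_topology)

lemma Hausdorff_sequence_space: "Hausdorff_space sequence_space"
  using metrizable_sequence_space by (rule metrizable_imp_Hausdorff_space)

lemma topspace_cantor_space [simp]: "topspace cantor_space = UNIV"
  by (simp add: cantor_space_def)

lemma compact_cantor_space: "compact_space cantor_space"
  by (simp add: cantor_space_def compact_space_product_topology compact_space_discrete_topology)

lemma Hausdorff_cantor_space: "Hausdorff_space cantor_space"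
  by (simp add: cantor_space_def Hausdorff_sequence_space)

lemma continuous_map_cantor_coordinate:
  "continuous_map cantor_space (discrete_topology UNIV) (\<lambda>x. x k)"
  unfolding cantor_space_def by (rule continuous_map_product_projection) simp

text \<open>A basic open neighbourhood constrains only finitely many coordinates, so flipping an
  unconstrained one stays inside it.\<close>

lemma cantor_space_not_isolated:
  assumes "openin cantor_space U" "x \<in> U"
  obtains y where "y \<in> U" "y \<noteq> x"
proof -
  obtain V :: "nat \<Rightarrow> bool set"
    where V: "finite {i. V i \<noteq> UNIV}" "x \<in> Pi\<^sub>E UNIV V" "Pi\<^sub>E UNIV V \<subseteq> U"
    using assms unfolding cantor_space_def openin_product_topology_alt by auto
  obtain k where "V k = UNIV"
    using ex_new_if_finite[OF infinite_UNIV_nat V(1)] by auto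
  with V(2) have "x(k := \<not> x k) \<in> Pi\<^sub>E UNIV V"
    by auto
  moreover have "x(k := \<not> x k) \<noteq> x"
    by (metis fun_upd_same)
  ultimately show ?thesis
    using V(3) that by blast
qed

section \<open>Baire category against well-ordered Cantor sets\<close>

text \<open>Two disjoint nonempty open subsets of \<open>U\<close> span an open box off the
  diagonal, which the closed sets \<open>P n\<close> and their converses cover. By Baire one of
  these contains a smaller open box; its sides are \<open>V\<close> and \<open>W\<close>, exchanged
  if it lies in a converse.\<close>

lemma cantor_space_closed_cover_box:
  fixes P :: "nat \<Rightarrow> ((nat \<Rightarrow> bool) \<times> (nat \<Rightarrow> bool)) set"
  assumes closed: "\<And>n. closedin (prod_topology cantor_space cantor_space) (P n)"
    and total: "\<And>x y. x \<noteq> y \<Longrightarrow> \<exists>n. (x, y) \<in> P n \<or> (y, x) \<in> P n"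
    and U: "openin cantor_space U" "U \<noteq> {}"
  obtains V W n where "openin cantor_space V" "V \<noteq> {}" "V \<subseteq> U" "W \<noteq> {}" "W \<subseteq> U" "V \<times> W \<subseteq> P n"
proof -
  let ?X = "prod_topology cantor_space cantor_space"
  obtain x y where xy: "x \<in> U" "y \<in> U" "x \<noteq> y"
    using U cantor_space_not_isolated by (metis ex_in_conv)
  obtain U1' U2' where "openin cantor_space U1'" "openin cantor_space U2'"
    "x \<in> U1'" "y \<in> U2'" "disjnt U1' U2'"
    using Hausdorff_cantor_space xy(3) unfolding Hausdorff_space_def by (metis UNIV_I topspace_cantor_space)
  then obtain U1 U2 where U12: "openin cantor_space U1" "openin cantor_space U2"
    "U1 \<noteq> {}" "U2 \<noteq> {}" "U1 \<subseteq> U" "U2 \<subseteq> U" "U1 \<inter> U2 = {}"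
    using xy U(1) that[of "U \<inter> U1'" "U \<inter> U2'"]
    by (metis (no_types, lifting) IntI Int_lower1 disjnt_def empty_iff inf.assoc inf.left_commute
        inf_bot_right openin_Int)
  define B where "B = U1 \<times> U2"
  \<comment> \<open>Cutting down to the closure of \<open>B\<close> keeps the sets closed and still
    covers \<open>B\<close>; it forces the interior that Baire provides to lie in that
    closure.\<close>
  define \<G> where "\<G> = (\<lambda>T. T \<inter> ?X closure_of B) ` (range P \<union> range (\<lambda>n. (P n)\<inverse>))"
  have B: "openin ?X B" "B \<noteq> {}"
    using U12 by (auto simp: B_def openin_prod_Times_iff)
  have swap: "closedin ?X ((P n)\<inverse>)" for n
  proof -
    have "continuous_map ?X ?X (\<lambda>(x, y). (y, x))"
      by (simp add: case_prod_unfold continuous_map_paired continuous_map_fst continuous_map_snd)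
    from closedin_continuous_map_preimage[OF this closed[of n]] show ?thesis
      by (rule back_subst[of "closedin ?X"]) auto
  qed
  have "locally_compact_space ?X" "regular_space ?X"
    by (simp_all add: compact_imp_locally_compact_space compact_space_prod_topology compact_cantor_space
        compact_Hausdorff_imp_regular_space Hausdorff_space_prod_topology Hausdorff_cantor_space)
  moreover have "countable \<G>"
    by (simp add: \<G>_def)
  moreover have closedG: "closedin ?X T" if "T \<in> \<G>" for T
    using that closed swap by (auto simp: \<G>_def)
  moreover have "?X interior_of \<Union>\<G> \<noteq> {}"
  proof -
    have "B \<subseteq> \<Union>\<G>"
    proof
      fix p assume p: "p \<in> B"
      obtain a b where ab: "p = (a, b)"
        by fastforce
      then have "a \<noteq> b"
        using p U12(7) by (auto simp: B_def)
      have "p \<in> ?X closure_of B"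
        using p B(1) by (meson closure_of_subset openin_subset subsetD)
      moreover obtain n where "(a, b) \<in> P n \<or> (b, a) \<in> P n"
        using total \<open>a \<noteq> b\<close> by blast
      ultimately show "p \<in> \<Union>\<G>"
        unfolding \<G>_def ab by blast
    qed
    then show ?thesis
      using B interior_of_maximal by fastforce
  qed
  ultimately obtain T where T: "T \<in> \<G>" "?X interior_of T \<noteq> {}"
    using Baire_category_alt[of ?X \<G>] by blast
  let ?O = "?X interior_of T"
  have "?O \<subseteq> ?X closure_of B"
    using interior_of_subset[of ?X T] T(1) by (auto simp: \<G>_def)
  then have "?O \<inter> ?X closure_of B = ?O"
    by (rule Int_absorb2)
  \<comment> \<open>An open set contained in the closure of \<open>B\<close> and missing
    \<open>B\<close> would be empty.\<close>
  then have "?O \<inter> B \<noteq> {}"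
    using T(2) openin_Int_closure_of_eq_empty[OF openin_interior_of, of ?X T B] by simp
  then obtain a b where ab: "(a, b) \<in> ?O \<inter> B"
    by auto
  have "openin ?X (?O \<inter> B)"
    using B(1) by auto
  then have "\<exists>V W. openin cantor_space V \<and> openin cantor_space W \<and>
      a \<in> V \<and> b \<in> W \<and> V \<times> W \<subseteq> ?O \<inter> B"
    using ab unfolding openin_prod_topology_alt by (elim allE impE)
  then obtain V W where VW: "openin cantor_space V" "openin cantor_space W"
    "a \<in> V" "b \<in> W" "V \<times> W \<subseteq> ?O \<inter> B"
    by (elim exE conjE)
  have "V \<subseteq> U1" "W \<subseteq> U2"
    using VW(3-5) unfolding B_def by blast+
  then have sub: "V \<subseteq> U" "W \<subseteq> U"
    using U12 by auto
  have VWT: "V \<times> W \<subseteq> T"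
    using VW(5) interior_of_subset[of ?X T] by blast
  from T(1) consider n where "T \<subseteq> P n" | n where "T \<subseteq> (P n)\<inverse>"
    by (auto simp: \<G>_def)
  then show ?thesis
  proof cases
    case 1
    with VWT have "V \<times> W \<subseteq> P n"
      by (rule subset_trans)
    with VW(1,3,4) sub show ?thesis
      by (metis that empty_iff)
  next
    case 2
    then have "W \<times> V \<subseteq> P n"
      using VWT by blast
    with VW(2,3,4) sub show ?thesis
      by (metis that empty_iff)
  qed
qed

lemma cantor_space_no_F_sigma_wellorder:
  fixes P :: "nat \<Rightarrow> ((nat \<Rightarrow> bool) \<times> (nat \<Rightarrow> bool)) set"
  assumes closed: "\<And>n. closedin (prod_topology cantor_space cantor_space) (P n)"
    and total: "\<And>x y. x \<noteq> y \<Longrightarrow> \<exists>n. (x, y) \<in> P n \<or> (y, x) \<in> P n"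
  shows "\<not> wf (\<Union>n. P n)"
proof
  assume wf: "wf (\<Union>n. P n)"
  note box = cantor_space_closed_cover_box[where P = P, OF closed total]
  \<comment> \<open>The infinite descent is run as an induction on an upper bound \<open>y\<close>
    of \<open>U\<close>: the box lemma gives a nonempty open \<open>V\<close> inside
    \<open>U\<close> below some \<open>w\<close> in \<open>U\<close>, and \<open>w\<close> is below
    \<open>y\<close>, against the induction hypothesis at \<open>w\<close>.\<close>
  have no_bound: "\<not> (openin cantor_space U \<and> U \<noteq> {} \<and> (\<forall>u\<in>U. (u, y) \<in> (\<Union>n. P n)))" for U y
    using wf
  proof (induction y arbitrary: U rule: wf_induct_rule)
    case (less y)
    show ?case
    proof
      assume U: "openin cantor_space U \<and> U \<noteq> {} \<and> (\<forall>u\<in>U. (u, y) \<in> (\<Union>n. P n))"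
      then obtain V W n where VW: "openin cantor_space V" "V \<noteq> {}" "V \<subseteq> U" "W \<noteq> {}" "W \<subseteq> U"
        "V \<times> W \<subseteq> P n"
        using box[of U] by metis
      then obtain w where w: "w \<in> W"
        by auto
      then have "(w, y) \<in> (\<Union>n. P n)"
        using U VW(5) by auto
      from less.IH[OF this, of V] show False
        using VW w by auto
    qed
  qed
  obtain V W n where VW: "openin cantor_space V" "V \<noteq> {}" "W \<noteq> {}" "V \<times> W \<subseteq> P n"
    using box[of UNIV] openin_topspace[of cantor_space] by (metis UNIV_not_empty topspace_cantor_space)
  then obtain w where "w \<in> W"
    by auto
  then show False
    using no_bound[of V w] VW by auto
qed

text \<open>A homeomorphism \<open>g\<close> from the Cantor space onto \<open>C\<close> would carry
  the order of the indices back to the Cantor space. Being increasing from coordinate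
  \<open>n\<close> on is a closed condition, so this would be an F-sigma well-order as just
  excluded.\<close>

lemma no_cantor_set_in_increasing_family:
  fixes f :: "'i \<Rightarrow> nat \<Rightarrow> 'b" and R :: "'i rel" and S :: "nat \<Rightarrow> 'b rel"
  assumes wf: "wf R"
    and total: "\<And>\<alpha> \<beta>. \<lbrakk>\<alpha> \<in> I; \<beta> \<in> I; \<alpha> \<noteq> \<beta>\<rbrakk> \<Longrightarrow> (\<alpha>, \<beta>) \<in> R \<or> (\<beta>, \<alpha>) \<in> R"
    and inc: "\<And>\<alpha> \<beta>. \<lbrakk>\<alpha> \<in> I; \<beta> \<in> I; (\<alpha>, \<beta>) \<in> R\<rbrakk> \<Longrightarrow> \<exists>N. \<forall>m\<ge>N. (f \<alpha> m, f \<beta> m) \<in> S m"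
    and asym: "\<And>m a b. (a, b) \<in> S m \<Longrightarrow> (b, a) \<notin> S m"
    and C: "C \<subseteq> f ` I"
  shows "\<not> subtopology sequence_space C homeomorphic_space cantor_space"
proof
  assume "subtopology sequence_space C homeomorphic_space cantor_space"
  then obtain g where g: "homeomorphic_map cantor_space (subtopology sequence_space C) g"
    by (meson homeomorphic_space_sym homeomorphic_space)
  have inj: "inj g" and gC: "range g \<subseteq> C"
    using homeomorphic_imp_injective_map[OF g] homeomorphic_imp_surjective_map[OF g] by auto
  have cont: "continuous_map cantor_space (discrete_topology UNIV) (\<lambda>x. g x m)" for m
    using homeomorphic_imp_continuous_map[OF g]
    by (simp add: continuous_map_in_subtopology continuous_map_componentwise_UNIV)
  \<comment> \<open>An index for each image point; \<open>h\<close> is injective because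
    \<open>g\<close> is and \<open>f (h x) = g x\<close>.\<close>
  define h where "h x = (SOME \<alpha>. \<alpha> \<in> I \<and> f \<alpha> = g x)" for x
  have h: "h x \<in> I" "f (h x) = g x" for x
  proof -
    have "\<exists>\<alpha>. \<alpha> \<in> I \<and> f \<alpha> = g x"
      using gC C by (metis imageE rangeI subsetD)
    from someI_ex[OF this] show "h x \<in> I" "f (h x) = g x"
      unfolding h_def by auto
  qed
  have h_inj: "h x \<noteq> h y" if "x \<noteq> y" for x y
    using that inj h(2) by (metis injD)
  define P where "P n = {(x, y). \<forall>m\<ge>n. (g x m, g y m) \<in> S m}" for n
  have closed: "closedin (prod_topology cantor_space cantor_space) (P n)" for n
  proof -
    let ?X = "prod_topology cantor_space cantor_space"
    \<comment> \<open>The pair of coordinates \<open>m\<close> maps continuously into a discrete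
      space, where every set is closed.\<close>
    have "closedin ?X {p \<in> topspace ?X. (g (fst p) m, g (snd p) m) \<in> S m}" for m
    proof -
      have "continuous_map ?X (prod_topology (discrete_topology UNIV) (discrete_topology UNIV))
        (\<lambda>p. (g (fst p) m, g (snd p) m))"
        unfolding continuous_map_paired
        using continuous_map_compose[OF continuous_map_fst cont[of m], of cantor_space]
          continuous_map_compose[OF continuous_map_snd cont[of m], of cantor_space]
        by (simp add: comp_def)
      from closedin_continuous_map_preimage[OF this, of "S m"] show ?thesis
        by (simp flip: prod_topology_discrete_topology)
    qed
    then have "closedin ?X (\<Inter>m\<in>{n..}. {p \<in> topspace ?X. (g (fst p) m, g (snd p) m) \<in> S m})"
      by (intro closedin_Inter) auto
    moreover have "(\<Inter>m\<in>{n..}. {p \<in> topspace ?X. (g (fst p) m, g (snd p) m) \<in> S m}) = P n"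
      by (auto simp: P_def)
    ultimately show ?thesis
      by simp
  qed
  have inc_g: "\<exists>n. (x, y) \<in> P n" if "(h x, h y) \<in> R" for x y
    using inc[OF h(1) h(1) that] by (simp add: P_def h(2))
  have "\<exists>n. (x, y) \<in> P n \<or> (y, x) \<in> P n" if "x \<noteq> y" for x y
    using total[OF h(1) h(1) h_inj[OF that]] inc_g by blast
  \<comment> \<open>The opposite index order would put both orientations of a pair into
    \<open>S\<close> at the common coordinate \<open>max n N\<close>, against asymmetry.\<close>
  moreover have "(\<Union>n. P n) \<subseteq> inv_image R h"
  proof
    fix p assume "p \<in> (\<Union>n. P n)"
    then obtain x y n where p: "p = (x, y)" and n: "\<forall>m\<ge>n. (g x m, g y m) \<in> S m"
      by (auto simp: P_def)
    have "x \<noteq> y"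
      using n asym by blast
    moreover have False if R: "(h y, h x) \<in> R"
    proof -
      obtain N where "\<forall>m\<ge>N. (g y m, g x m) \<in> S m"
        using inc[OF h(1) h(1) R] by (auto simp: h(2))
      then show False
        using n asym[of "g x (max n N)" "g y (max n N)" "max n N"] by simp
    qed
    ultimately show "p \<in> inv_image R h"
      using total[OF h(1) h(1) h_inj] by (auto simp: p)
  qed
  ultimately show False
    using cantor_space_no_F_sigma_wellorder[of P] closed wf
    by (meson wf_inv_image wf_subset)
qed

section \<open>Successors of the continuum and their supremum\<close>

lemma card_of_cantor: "|UNIV :: (nat \<Rightarrow> bool) set| =o ctwo ^c natLeq"
proof -
  have "Func UNIV UNIV = (UNIV :: (nat \<Rightarrow> bool) set)"
    by (auto simp: Func_def)
  then show ?thesis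
    by (simp add: cexp_def ctwo_def Field_natLeq Field_card_of card_of_refl)
qed

lemma is_c_plus_Cinfinite: "is_c_plus n (r :: 'a rel) \<Longrightarrow> Cinfinite r"
proof (induction n arbitrary: r)
  case 0
  have "Cinfinite (ctwo ^c natLeq)"
    by (rule Cinfinite_cexp[OF ordLeq_refl natLeq_Cinfinite]) (rule Card_order_ctwo)
  then show ?case
    using 0 Cinfinite_cong[OF ordIso_symmetric] by simp
next
  case (Suc n)
  then obtain s :: "'a rel" where "Cinfinite s" "r =o cardSuc s"
    by auto
  then show ?case
    using Cinfinite_cong[OF ordIso_symmetric Cinfinite_cardSuc] by blast
qed

text \<open>Infinite successor cardinals are regular. The continuum itself may be singular, which is
  one reason why coordinate \<open>n\<close> of the branches built later lives in
  \<open>r (Suc n)\<close>.\<close>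

lemma is_c_plus_Suc_regularCard:
  fixes r :: "'a rel"
  assumes "is_c_plus (Suc n) r"
  shows "regularCard r"
proof -
  obtain s :: "'a rel" where "is_c_plus n s" "r =o cardSuc s"
    using assms by auto
  then show ?thesis
    using is_c_plus_Cinfinite Cinfinite_cardSuc regularCard_cardSuc regularCard_ordIso ordIso_symmetric
    by blast
qed

lemma is_c_plus_less_Suc:
  fixes r :: "'a rel" and r' :: "'b rel"
  assumes "is_c_plus n r" "is_c_plus (Suc n) r'"
  shows "r <o r'"
proof -
  obtain s :: "'b rel" where s: "is_c_plus n s" "r' =o cardSuc s"
    using assms(2) by auto
  have "r =o s"
    using is_c_plus_unique assms(1) s(1) by blast
  also have "s <o cardSuc s"
    using is_c_plus_Card_order[OF s(1)] by (rule cardSuc_greater)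
  also have "cardSuc s =o r'"
    using s(2) by (rule ordIso_symmetric)
  finally show ?thesis .
qed

text \<open>If every \<open>r n\<close> were at most the cardinality of a proper initial segment of
  \<open>s\<close>, that cardinality would be an upper bound contradicting the leastness of
  \<open>s\<close>.\<close>

lemma is_c_plus_omega_cofinal_sequence:
  fixes s :: "'a rel"
  assumes s: "is_c_plus_omega s"
  obtains r :: "nat \<Rightarrow> 'a rel"
  where "\<And>n. is_c_plus n (r n)" "\<And>n. r n <o s"
    "\<And>x. x \<in> Field s \<Longrightarrow> \<exists>n. |underS s x| <o r n"
proof -
  obtain r :: "nat \<Rightarrow> 'a rel" where r: "\<And>n. is_c_plus n (r n)" "\<And>n. r n \<le>o s"
    using s unfolding is_c_plus_omega_def by metis
  have less: "r n <o s" for n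
    using is_c_plus_less_Suc[OF r(1) r(1)] r(2) ordLess_ordLeq_trans by blast
  have "\<exists>n. |underS s x| <o r n" if x: "x \<in> Field s" for x
  proof (rule ccontr)
    assume "\<nexists>n. |underS s x| <o r n"
    then have "r n \<le>o |underS s x|" for n
      using ordLess_or_ordLeq[OF card_of_Well_order, of "r n" "underS s x"]
        is_c_plus_Card_order[OF r(1)] unfolding card_order_on_def by blast
    then have le: "Card_order |underS s x| \<and> (\<forall>n. \<exists>r :: 'a rel. is_c_plus n r \<and> r \<le>o |underS s x| )"
      using r(1) card_of_Card_order by blast
    have least: "\<forall>t :: 'a rel. Card_order t \<and> (\<forall>n. \<exists>r :: 'a rel. is_c_plus n r \<and> r \<le>o t) \<longrightarrow> s \<le>o t"
      using s by (simp add: is_c_plus_omega_def)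
    have "s \<le>o |underS s x|"
      by (rule mp[OF spec[OF least] le])
    moreover have "|underS s x| <o s"
      using s x by (simp add: is_c_plus_omega_def card_of_underS)
    ultimately show False
      using not_ordLess_ordLeq by blast
  qed
  with r(1) less show ?thesis
    using that by blast
qed

text \<open>A strictly smaller well-order is isomorphic to a proper initial segment of the larger
  one.\<close>

lemma ordLess_imp_card_of_underS:
  fixes r :: "'a rel" and s :: "'b rel"
  assumes "Card_order r" "Card_order s" "r <o s"
  obtains x where "x \<in> Field s" "|underS s x| =o r"
proof -
  have wo: "Well_order s" "Well_order r"
    using assms unfolding card_order_on_def by auto
  obtain x where x: "x \<in> Field s" "r =o Restr s (underS s x)"
    using ordLess_iff_ordIso_Restr[OF wo] assms(3) by blast
  have "Field (Restr s (underS s x)) = underS s x"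
    using wo(1) by (simp add: Field_Restr_ofilter wo_rel.underS_ofilter wo_rel_def)
  then have "|Field r| =o |underS s x|"
    using card_of_cong[OF x(2)] by simp
  moreover have "|Field r| =o r"
    using assms(1) by (rule card_of_Field_ordIso)
  ultimately show ?thesis
    using that[OF x(1)] ordIso_symmetric ordIso_transitive by blast
qed

text \<open>The sets \<open>B n\<close> are initial segments of \<open>s\<close> of size
  \<open>r n\<close>. They will ration the predecessors in the diagonalisation, each being smaller
  than the regular cardinal \<open>r (Suc n)\<close>.\<close>

lemma is_c_plus_omega_filtration:
  fixes s :: "'a rel"
  assumes s: "is_c_plus_omega s"
  obtains r :: "nat \<Rightarrow> 'a rel" and B :: "nat \<Rightarrow> 'a set"
  where "\<And>n. is_c_plus n (r n)" "\<And>n. r n <o s"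
    "\<And>n. |B n| =o r n" "incseq B" "(\<Union>n. B n) = Field s"
proof -
  obtain r :: "nat \<Rightarrow> 'a rel" where r: "\<And>n. is_c_plus n (r n)" "\<And>n. r n <o s"
    and cof: "\<And>x. x \<in> Field s \<Longrightarrow> \<exists>n. |underS s x| <o r n"
    using is_c_plus_omega_cofinal_sequence[OF s] by blast
  have co: "Card_order s"
    using s unfolding is_c_plus_omega_def by blast
  then have wo: "wo_rel s"
    unfolding card_order_on_def wo_rel_def by simp
  have "\<exists>x. x \<in> Field s \<and> |underS s x| =o r n" for n
    using ordLess_imp_card_of_underS[OF is_c_plus_Card_order[OF r(1)] co r(2)] by blast
  then obtain x where x: "\<And>n. x n \<in> Field s" "\<And>n. |underS s (x n)| =o r n"
    by metis
  \<comment> \<open>Initial segments of a well-order are comparable, so smaller cardinality forces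
    an earlier endpoint. This serves both for monotonicity and for exhausting
    \<open>Field s\<close>.\<close>
  have below: "underS s y \<subseteq> underS s z \<and> (y = z \<or> y \<in> underS s z)" 
    if yz: "y \<in> Field s" "z \<in> Field s" "|underS s y| <o |underS s z|" for y z
  proof -
    have "\<not> underS s z \<subseteq> underS s y"
      using yz(3) card_of_mono1 not_ordLess_ordLeq by blast
    then have "(z, y) \<notin> s"
      using underS_incr[OF wo_rel.TRANS[OF wo] wo_rel.ANTISYM[OF wo]] by blast
    then have "(y, z) \<in> s" "y \<noteq> z"
      using wo_rel.TOTALS[OF wo] yz by auto
    then show ?thesis
      using underS_incr[OF wo_rel.TRANS[OF wo] wo_rel.ANTISYM[OF wo]] by (auto simp: underS_def)
  qed
  have "|underS s (x n)| <o |underS s (x (Suc n))|" for n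
    using x(2) is_c_plus_less_Suc[OF r(1) r(1)] ordIso_ordLess_trans ordLess_ordIso_trans ordIso_symmetric
    by metis
  then have "incseq (\<lambda>n. underS s (x n))"
    using below x(1) by (intro incseq_SucI) blast
  moreover have "(\<Union>n. underS s (x n)) = Field s"
  proof
    show "(\<Union>n. underS s (x n)) \<subseteq> Field s"
      by (auto simp: underS_def Field_def)
    show "Field s \<subseteq> (\<Union>n. underS s (x n))"
    proof
      fix y assume y: "y \<in> Field s"
      then obtain n where "|underS s y| <o r n"
        using cof by blast
      then have "|underS s y| <o |underS s (x n)|"
        using x(2) ordIso_symmetric ordLess_ordIso_trans by blast
      then have "y \<in> underS s (x n)"
        using below[OF y x(1)] ordLess_irreflexive by blast
      then show "y \<in> (\<Union>n. underS s (x n))"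
        by blast
    qed
  qed
  ultimately show ?thesis
    using that[OF r(1) r(2) x(2)] by blast
qed

section \<open>Diagonalisation modulo finite sets\<close>

text \<open>Regularity makes \<open>K\<close> non-cofinal, which gives only a weak bound
  \<open>b\<close>; an infinite cardinal has no greatest element, so some \<open>c\<close> beyond
  \<open>b\<close> is a strict bound.\<close>

lemma regularCard_strict_bound:
  assumes r: "Cinfinite r" "regularCard r" and K: "K \<subseteq> Field r" "|K| <o r"
  shows "\<exists>b\<in>Field r. \<forall>a\<in>K. (a, b) \<in> r - Id"
proof -
  have wo: "wo_rel r"
    using r unfolding card_order_on_def wo_rel_def by simp
  have "\<not> cofinal K r"
    using r(2) K not_ordLess_ordIso unfolding regularCard_def by blast
  then obtain b where b: "b \<in> Field r" "\<forall>a\<in>K. b = a \<or> (b, a) \<notin> r"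
    unfolding cofinal_def by blast
  then have b_ge: "(a, b) \<in> r" if "a \<in> K" for a
    using that wo_rel.TOTALS[OF wo] K by (metis subsetD)
  obtain c where c: "c \<in> Field r" "b \<noteq> c" "(b, c) \<in> r"
    using infinite_Card_order_limit[OF _ _ b(1)] r unfolding cinfinite_def by blast
  have "(a, c) \<in> r - Id" if "a \<in> K" for a
    using b_ge[OF that] c wo_rel.TRANS[OF wo] wo_rel.ANTISYM[OF wo]
    by (auto dest: transD antisymD)
  with c(1) show ?thesis
    by blast
qed

text \<open>
  Diagonalisation: \<open>\<beta> < \<alpha>\<close> is dealt with at all coordinates from some point on, and only few
  \<open>\<beta>\<close> are dealt with at each single coordinate.
\<close>

lemma eventually_increasing_family:
  fixes k :: "'i rel" and r :: "nat \<Rightarrow> 'a rel" and B :: "nat \<Rightarrow> 'b set"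
  assumes k: "Well_order k" and pred: "\<And>\<alpha>. |underS k \<alpha>| \<le>o |\<Union>n. B n|"
    and r: "\<And>n. Cinfinite (r n)" "\<And>n. regularCard (r n)"
    and B: "\<And>n. |B n| <o r n" "incseq B"
  obtains f where "\<And>\<alpha> n. f \<alpha> n \<in> Field (r n)"
    "\<And>\<alpha> \<beta>. (\<alpha>, \<beta>) \<in> k - Id \<Longrightarrow> \<exists>N. \<forall>n\<ge>N. (f \<alpha> n, f \<beta> n) \<in> r n - Id"
proof -
  have "\<exists>g. inj_on g (underS k \<alpha>) \<and> g ` underS k \<alpha> \<subseteq> (\<Union>n. B n)" for \<alpha>
    using pred[of \<alpha>] by (simp add: card_of_ordLeq)
  then obtain g where g: "\<And>\<alpha>. inj_on (g \<alpha>) (underS k \<alpha>)" "\<And>\<alpha>. g \<alpha> ` underS k \<alpha> \<subseteq> (\<Union>n. B n)"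
    by metis
  \<comment> \<open>\<open>g \<alpha>\<close> codes the predecessors of \<alpha> by elements of the
    union; \<open>A \<alpha> n\<close> is the batch of those to be exceeded at coordinate
    \<open>n\<close>.\<close>
  define A where "A \<alpha> n = {\<beta> \<in> underS k \<alpha>. g \<alpha> \<beta> \<in> B n}" for \<alpha> n
  have A_small: "|A \<alpha> n| <o r n" for \<alpha> n
  proof -
    have "|A \<alpha> n| \<le>o |B n|"
      by (rule card_of_ordLeqI[of "g \<alpha>"]) (auto simp: A_def intro: inj_on_subset[OF g(1)[of \<alpha>]])
    then show ?thesis
      using B(1) ordLeq_ordLess_trans by blast
  qed
  define P where "P f \<alpha> h \<longleftrightarrow> (\<forall>n. h n \<in> Field (r n) \<and> (\<forall>\<beta>\<in>A \<alpha> n. (f \<beta> n, h n) \<in> r n - Id))"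
    for f :: "'i \<Rightarrow> nat \<Rightarrow> 'a" and \<alpha> h
  have "\<exists>f. \<forall>\<alpha>. P f \<alpha> (f \<alpha>)"
  \<comment> \<open>Admissibility of \<open>h\<close> at \<alpha> depends only on earlier values of
    \<open>f\<close>. The hypothesis on these keeps them in \<open>Field (r n)\<close>, where a
    batch smaller than the regular cardinal \<open>r n\<close> has a strict upper bound.\<close>
  proof (rule dependent_wf_choice[of "k - Id"])
    show "wf (k - Id)"
      using k by (simp add: well_order_on_def)
    show "P f \<alpha> h = P f' \<alpha> h" if "\<And>\<beta>. (\<beta>, \<alpha>) \<in> k - Id \<Longrightarrow> f \<beta> = f' \<beta>" for f f' \<alpha> h
      using that by (auto simp: P_def A_def underS_def)
    show "\<exists>h. P f \<alpha> h" if IH: "\<And>\<beta>. (\<beta>, \<alpha>) \<in> k - Id \<Longrightarrow> P f \<beta> (f \<beta>)" for \<alpha> f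
    proof -
      have "\<exists>b\<in>Field (r n). \<forall>a\<in>(\<lambda>\<beta>. f \<beta> n) ` A \<alpha> n. (a, b) \<in> r n - Id" for n
      proof (rule regularCard_strict_bound[OF r])
        show "(\<lambda>\<beta>. f \<beta> n) ` A \<alpha> n \<subseteq> Field (r n)"
          using IH by (auto simp: P_def A_def underS_def)
        show "|(\<lambda>\<beta>. f \<beta> n) ` A \<alpha> n| <o r n"
          using A_small card_of_image ordLeq_ordLess_trans by blast
      qed
      then have "\<exists>b. b \<in> Field (r n) \<and> (\<forall>\<beta>\<in>A \<alpha> n. (f \<beta> n, b) \<in> r n - Id)" for n
        by blast
      then show ?thesis
        unfolding P_def by metis
    qed
  qed
  then obtain f where f: "\<And>\<alpha>. P f \<alpha> (f \<alpha>)"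
    by blast
  have "\<exists>N. \<forall>n\<ge>N. (f \<alpha> n, f \<beta> n) \<in> r n - Id" if "(\<alpha>, \<beta>) \<in> k - Id" for \<alpha> \<beta>
  proof -
    have \<alpha>: "\<alpha> \<in> underS k \<beta>"
      using that by (auto simp: underS_def)
    then obtain N where "g \<beta> \<alpha> \<in> B N"
      using g(2) by blast
    then have "\<alpha> \<in> A \<beta> n" if "n \<ge> N" for n
      using \<alpha> that incseqD[OF B(2) that] by (auto simp: A_def)
    then show ?thesis
      using f unfolding P_def by blast
  qed
  moreover have "f \<alpha> n \<in> Field (r n)" for \<alpha> n
    using f unfolding P_def by blast
  ultimately show ?thesis
    using that by blast
qed

section \<open>Transport along homeomorphisms\<close>

text \<open>The space will be built from sequences over \<open>'a + bool\<close>, whereas a topology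
  on \<open>'a\<close> is wanted; pulling back along a bijection moves it there.\<close>

lemma homeomorphic_copy_on_set:
  fixes X :: "'b topology" and A :: "'a set"
  assumes "|topspace X| =o |A|"
  obtains Y :: "'a topology" where "topspace Y = A" "Y homeomorphic_space X"
proof -
  obtain g where g: "bij_betw g (topspace X) A"
    using assms card_of_ordIso by blast
  define f where "f = inv_into (topspace X) g"
  have f: "bij_betw f A (topspace X)"
    unfolding f_def using g by (rule bij_betw_inv_into)
  have fg: "f (g x) = x" if "x \<in> topspace X" for x
    unfolding f_def using g that by (rule bij_betw_inv_into_left)
  have gf: "g (f a) = a" if "a \<in> A" for a
    unfolding f_def using g that by (rule bij_betw_inv_into_right)
  define Y where "Y = pullback_topology A f X"
  have top: "topspace Y = A"
    using f by (auto simp: Y_def topspace_pullback_topology bij_betw_def)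
  have "continuous_map Y X f"
    using continuous_map_pullback[OF continuous_map_id, where f = f and A = A] by (simp add: Y_def)
  moreover have "continuous_map X Y g"
    unfolding Y_def
  proof (rule continuous_map_pullback')
    show "continuous_map X X (f \<circ> g)"
      by (rule continuous_map_eq[OF continuous_map_id]) (simp add: fg)
    show "topspace X \<subseteq> g -` A"
      using g by (auto simp: bij_betw_def)
  qed
  ultimately have "homeomorphic_maps Y X f g"
    by (simp add: homeomorphic_maps_def top fg gf)
  then show ?thesis
    using that[OF top] by (auto simp: homeomorphic_space_def)
qed

lemma homeomorphic_space_subtopology_image:
  assumes "homeomorphic_map X Y f" "C \<subseteq> topspace X"
  shows "subtopology Y (f ` C) homeomorphic_space subtopology X C"
proof -
  have "homeomorphic_map (subtopology X C) (subtopology Y (f ` C)) f"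
    using assms homeomorphic_imp_surjective_map[OF assms(1)]
    by (intro homeomorphic_map_subtopologies) auto
  then show ?thesis
    using homeomorphic_map_imp_homeomorphic_space homeomorphic_space_sym by blast
qed

lemma homeomorphic_imp_cantor_coverable:
  assumes "X homeomorphic_space Y" "cantor_coverable X"
  shows "cantor_coverable Y"
proof -
  obtain f where f: "homeomorphic_map X Y f"
    using assms(1) homeomorphic_space by blast
  obtain \<C> where \<C>: "\<Union>\<C> = topspace X"
      "\<And>C. C \<in> \<C> \<Longrightarrow> subtopology X C homeomorphic_space cantor_space"
    using assms(2) unfolding cantor_coverable_def by blast
  have "\<Union>((`) f ` \<C>) = f ` topspace X"
    using \<C>(1) by auto
  then have "\<Union>((`) f ` \<C>) = topspace Y"
    using homeomorphic_imp_surjective_map[OF f] by simp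
  moreover have "subtopology Y (f ` C) homeomorphic_space cantor_space" if "C \<in> \<C>" for C
    using homeomorphic_space_trans[OF homeomorphic_space_subtopology_image[OF f] \<C>(2)[OF that]]
      \<C>(1) that by blast
  ultimately show ?thesis
    unfolding cantor_coverable_def by blast
qed

lemma homeomorphic_imp_cantor_partitionable:
  assumes "X homeomorphic_space Y" "cantor_partitionable X"
  shows "cantor_partitionable Y"
proof -
  obtain f where f: "homeomorphic_map X Y f"
    using assms(1) homeomorphic_space by blast
  obtain \<C> where \<C>: "\<Union>\<C> = topspace X" "disjoint \<C>"
      "\<And>C. C \<in> \<C> \<Longrightarrow> subtopology X C homeomorphic_space cantor_space"
    using assms(2) unfolding cantor_partitionable_def by metis
  have "\<Union>((`) f ` \<C>) = f ` topspace X"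
    using \<C>(1) by auto
  then have "\<Union>((`) f ` \<C>) = topspace Y"
    using homeomorphic_imp_surjective_map[OF f] by simp
  moreover have "disjoint ((`) f ` \<C>)"
    using homeomorphic_imp_injective_map[OF f] \<C>(1,2) by (intro disjoint_image) simp_all
  moreover have "subtopology Y (f ` C) homeomorphic_space cantor_space" if "C \<in> \<C>" for C
    using homeomorphic_space_trans[OF homeomorphic_space_subtopology_image[OF f] \<C>(3)[OF that]]
      \<C>(1) that by blast
  ultimately show ?thesis
    unfolding cantor_partitionable_def by blast
qed

section \<open>Cantor sets along a branch\<close>

text \<open>
  The image of \<open>cantor_branch z\<close> consists of the branch \<open>z\<close> itself and of a copy of the Cantor space
  attached to every finite initial segment of \<open>z\<close>.
\<close>

definition cantor_branch :: "(nat \<Rightarrow> 'a) \<Rightarrow> (nat \<Rightarrow> bool) \<Rightarrow> nat \<Rightarrow> 'a + bool" where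
  "cantor_branch z y i = (if \<forall>j\<le>i. y j then Inl (z i) else Inr (y (Suc i)))"

lemma cantor_branch_all_True: "cantor_branch z (\<lambda>_. True) = Inl \<circ> z"
  by (auto simp: cantor_branch_def)

text \<open>The first \<open>Inr\<close> entry marks the first position where \<open>y\<close> is
  False, and the entries from there on list the later bits of \<open>y\<close>. The shift
  \<open>Suc i\<close> in the definition skips the False bit, which its position already
  records.\<close>

lemma inj_cantor_branch: "inj (cantor_branch z)"
proof
  fix y y' assume "cantor_branch z y = cantor_branch z y'"
  then have eq: "cantor_branch z y i = cantor_branch z y' i" for i
    by simp
  have "y k = y' k" for k
  proof (cases k)
    case 0
    then show ?thesis
      using eq[of 0] by (auto simp: cantor_branch_def split: if_splits)
  next
    case (Suc i)
    show ?thesis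
    proof (cases "\<forall>j\<le>i. y j")
      case True
      then have "\<forall>j\<le>i. y' j"
        using eq[of i] by (auto simp: cantor_branch_def split: if_splits)
      then show ?thesis
        using True eq[of "Suc i"] Suc by (auto simp: cantor_branch_def le_Suc_eq split: if_splits)
    next
      case False
      then show ?thesis
        using eq[of i] Suc by (auto simp: cantor_branch_def split: if_splits)
    qed
  qed
  then show "y = y'"
    by blast
qed

text \<open>Coordinate \<open>i\<close> is constant on the clopen set where \<open>y\<close> is True
  up to \<open>i\<close>, and copies one coordinate of \<open>y\<close> on the complement.\<close>

lemma continuous_map_cantor_branch: "continuous_map cantor_space sequence_space (cantor_branch z)"
  unfolding continuous_map_componentwise_UNIV
proof
  fix i
  have clopen: "openin cantor_space {y. \<forall>j\<le>i. y j} \<and> openin cantor_space {y. \<not> (\<forall>j\<le>i. y j)}"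
  proof -
    have "openin cantor_space {y. y j = b}" for j b
      using openin_continuous_map_preimage[OF continuous_map_cantor_coordinate[of j], of "{b}"] by simp
    from this[of _ True] this[of _ False]
    have "openin cantor_space (\<Inter>j\<in>{..i}. {y. y j = True})" "openin cantor_space (\<Union>j\<in>{..i}. {y. y j = False})"
      by (intro openin_Inter openin_Union; auto)+
    moreover have "(\<Inter>j\<in>{..i}. {y. y j = True}) = {y. \<forall>j\<le>i. y j}" 
      "(\<Union>j\<in>{..i}. {y. y j = False}) = {y. \<not> (\<forall>j\<le>i. y j)}"
      by auto
    ultimately show ?thesis
      by simp
  qed
  have "openin cantor_space {y. cantor_branch z y i \<in> U}" for U
  proof -
    have "openin cantor_space {y. Inr (y (Suc i)) \<in> U}"
      using openin_continuous_map_preimage[OF continuous_map_cantor_coordinate[of "Suc i"], of "{b. Inr b \<in> U}"]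
      by simp
    moreover have "openin cantor_space {y. Inl (z i) \<in> U}"
      using openin_topspace[of cantor_space] by (cases "Inl (z i) \<in> U") simp_all
    ultimately have "openin cantor_space ({y. \<forall>j\<le>i. y j} \<inter> {y. Inl (z i) \<in> U} \<union>
        {y. \<not> (\<forall>j\<le>i. y j)} \<inter> {y. Inr (y (Suc i)) \<in> U})"
      using clopen by blast
    moreover have "{y. \<forall>j\<le>i. y j} \<inter> {y. Inl (z i) \<in> U} \<union>
        {y. \<not> (\<forall>j\<le>i. y j)} \<inter> {y. Inr (y (Suc i)) \<in> U} = {y. cantor_branch z y i \<in> U}"
      by (auto simp: cantor_branch_def)
    ultimately show ?thesis
      by simp
  qed
  then show "continuous_map cantor_space (discrete_topology UNIV) (\<lambda>y. cantor_branch z y i)"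
    by (simp add: continuous_map_def)
qed

lemma cantor_branch_image_homeomorphic:
  "subtopology sequence_space (range (cantor_branch z)) homeomorphic_space cantor_space"
proof -
  have "embedding_map cantor_space sequence_space (cantor_branch z)"
    using continuous_map_cantor_branch compact_cantor_space Hausdorff_sequence_space
    by (rule continuous_imp_embedding_map) (simp add: inj_cantor_branch)
  then show ?thesis
    unfolding embedding_map_def
    using homeomorphic_map_imp_homeomorphic_space homeomorphic_space_sym by force
qed

section \<open>Counting the points off the branches\<close>

text \<open>These sets enclose the attached Cantor sets. A stem may be any word over
  \<open>F\<close>, whether or not a branch passes through it, so that the size can be bounded by
  induction on \<open>n\<close>.\<close>

definition stem_sequences :: "'a set \<Rightarrow> nat \<Rightarrow> (nat \<Rightarrow> 'a + bool) set" where
  "stem_sequences F n = {x. (\<forall>i<n. x i \<in> Inl ` F) \<and> (\<forall>i\<ge>n. x i \<in> range Inr)}"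

lemma cantor_branch_in_stem_sequences:
  assumes "range z \<subseteq> F" "y \<noteq> (\<lambda>_. True)"
  shows "\<exists>n. cantor_branch z y \<in> stem_sequences F n"
proof -
  have "\<exists>n. \<not> y n"
    using assms(2) by blast
  \<comment> \<open>The stem ends at the first False position of \<open>y\<close>.\<close>
  define n where "n = (LEAST n. \<not> y n)"
  have "\<not> y n"
    unfolding n_def using \<open>\<exists>n. \<not> y n\<close> by (rule LeastI_ex)
  moreover have "y j" if "j < n" for j
    using that not_less_Least unfolding n_def by blast
  moreover have "z i \<in> F" for i
    using assms(1) by blast
  ultimately have "cantor_branch z y \<in> stem_sequences F n"
    by (auto simp: stem_sequences_def cantor_branch_def)
  then show ?thesis
    by blast
qed

text \<open>With an empty stem only a bit sequence is left, which accounts for the continuum.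
  Otherwise the first entry splits off, and the infinite \<open>r\<close> absorbs the product with
  \<open>F\<close>.\<close>

lemma card_of_stem_sequences:
  fixes r :: "'c rel" and F :: "'a set"
  assumes r: "Cinfinite r" and F: "|F| \<le>o r" and c: "|UNIV :: (nat \<Rightarrow> bool) set| \<le>o r"
  shows "|stem_sequences F n| \<le>o r"
proof (induction n)
  case 0
  have "|stem_sequences F 0| \<le>o |UNIV :: (nat \<Rightarrow> bool) set|"
  proof (rule card_of_ordLeqI)
    show "inj_on (\<lambda>x i. projr (x i)) (stem_sequences F 0)"
    proof (rule inj_onI)
      fix x y assume xy: "x \<in> stem_sequences F 0" "y \<in> stem_sequences F 0"
        and eq: "(\<lambda>i. projr (x i)) = (\<lambda>i. projr (y i))"
      have "x i = y i" for i
      proof -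
        have "x i \<in> range Inr" "y i \<in> range Inr"
          using xy by (auto simp: stem_sequences_def)
        moreover have "projr (x i) = projr (y i)"
          using fun_cong[OF eq, of i] by simp
        ultimately show ?thesis
          by auto
      qed
      then show "x = y"
        by blast
    qed
  qed simp
  then show ?case
    using c by (rule ordLeq_transitive)
next
  case (Suc n)
  have "|stem_sequences F (Suc n)| \<le>o |F \<times> stem_sequences F n|"
  proof (rule card_of_ordLeqI)
    show "inj_on (\<lambda>x. (projl (x 0), \<lambda>i. x (Suc i))) (stem_sequences F (Suc n))"
    proof (rule inj_onI)
      fix x y assume xy: "x \<in> stem_sequences F (Suc n)" "y \<in> stem_sequences F (Suc n)"
        and eq: "(projl (x 0), \<lambda>i. x (Suc i)) = (projl (y 0), \<lambda>i. y (Suc i))"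
      have "x 0 \<in> Inl ` F" "y 0 \<in> Inl ` F"
        using xy by (auto simp: stem_sequences_def)
      then have "x 0 = y 0"
        using eq by auto
      moreover have "x (Suc i) = y (Suc i)" for i
        using eq by (auto dest: fun_cong)
      ultimately show "x = y"
        by (metis ext not0_implies_Suc)
    qed
    fix x assume "x \<in> stem_sequences F (Suc n)"
    then show "(projl (x 0), \<lambda>i. x (Suc i)) \<in> F \<times> stem_sequences F n"
      by (fastforce simp: stem_sequences_def)
  qed
  moreover have "|F \<times> stem_sequences F n| \<le>o r"
    using r F Suc.IH by (auto simp: cinfinite_def intro: card_of_Times_ordLeq_infinite_Field)
  ultimately show ?case
    by (rule ordLeq_transitive)
qed

lemma card_of_homeomorphic_cantor:
  assumes "subtopology X C homeomorphic_space cantor_space" "C \<subseteq> topspace X"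
  shows "|C| =o ctwo ^c natLeq"
proof -
  obtain h where h: "homeomorphic_map (subtopology X C) cantor_space h"
    using assms(1) homeomorphic_space by blast
  have "bij_betw h C UNIV"
    using homeomorphic_imp_injective_map[OF h] homeomorphic_imp_surjective_map[OF h]
    by (simp add: bij_betw_def topspace_subtopology_subset[OF assms(2)] del: topspace_subtopology)
  then have "|C| =o |UNIV :: (nat \<Rightarrow> bool) set|"
    using card_of_ordIso by blast
  then show ?thesis
    using card_of_cantor by (rule ordIso_transitive)
qed

text \<open>A point of \<open>Y\<close> chosen in each member determines that member, by
  disjointness.\<close>

lemma disjoint_choice_card_of:
  assumes "disjoint \<C>" and "\<And>C. C \<in> \<C> \<Longrightarrow> C \<inter> Y \<noteq> {}"
  shows "|\<C>| \<le>o |Y|"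
proof -
  have "\<forall>C\<in>\<C>. \<exists>x. x \<in> C \<inter> Y"
    using assms(2) by blast
  then obtain e where e: "\<And>C. C \<in> \<C> \<Longrightarrow> e C \<in> C \<inter> Y"
    by metis
  show ?thesis
  proof (rule card_of_ordLeqI)
    show "inj_on e \<C>"
    proof (rule inj_onI)
      fix C D assume "C \<in> \<C>" "D \<in> \<C>" "e C = e D"
      then have "e C \<in> C \<inter> D"
        using e by (metis IntD1 IntI)
      then show "C = D"
        using assms(1) \<open>C \<in> \<C>\<close> \<open>D \<in> \<C>\<close> by (auto simp: disjoint_def)
    qed
  qed (use e in auto)
qed

section \<open>Construction of the space and its properties\<close>

theorem theorem3p8:
  fixes \<kappa> :: "'a rel"
  assumes "is_c_plus_omega_plus_1 \<kappa>"
  shows "\<exists>X :: 'a topology. metrizable_space X \<and> |topspace X| =o \<kappa> \<and>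
           cantor_coverable X \<and> \<not> cantor_partitionable X"
proof -
  obtain s :: "'a rel" where s: "is_c_plus_omega s" and ks: "\<kappa> =o cardSuc s"
    using assms unfolding is_c_plus_omega_plus_1_def by blast
  have cs: "Card_order s"
    using s by (simp add: is_c_plus_omega_def)
  have ck: "Card_order \<kappa>"
    using Card_order_ordIso[OF cardSuc_Card_order[OF cs] ks] .
  have sk: "s <o \<kappa>"
    using cardSuc_greater[OF cs] ordIso_symmetric[OF ks] by (rule ordLess_ordIso_trans)
  obtain r :: "nat \<Rightarrow> 'a rel" and B :: "nat \<Rightarrow> 'a set"
    where r: "\<And>n. is_c_plus n (r n)" "\<And>n. r n <o s"
      and B: "\<And>n. |B n| =o r n" "incseq B" "(\<Union>n. B n) = Field s"
    using is_c_plus_omega_filtration[OF s] by blast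
  define c where "c = |UNIV :: (nat \<Rightarrow> bool) set|"
  have "c =o r 0"
    unfolding c_def using card_of_cantor r(1)[of 0] ordIso_transitive ordIso_symmetric by fastforce
  then have cs_le: "c \<le>o s"
    using r(2)[of 0] ordIso_ordLess_trans ordLess_imp_ordLeq by blast
  have cinf_s: "Cinfinite s"
    using cinfinite_mono[OF ordLess_imp_ordLeq[OF r(2)]] is_c_plus_Cinfinite[OF r(1)] cs by blast
  then have inf_s: "infinite (Field s)" and "infinite (Field \<kappa>)"
    using cinfinite_mono[OF ordLess_imp_ordLeq[OF sk]] by (auto simp: cinfinite_def)

  \<comment> \<open>The index shift makes coordinate \<open>n\<close> range over a regular cardinal
    that exceeds the size \<open>r n\<close> of \<open>B n\<close>.\<close>
  obtain f where f:
    "\<And>\<alpha> n. f \<alpha> n \<in> Field (r (Suc n))"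
    and f_inc: "\<And>\<alpha> \<beta>. (\<alpha>, \<beta>) \<in> \<kappa> - Id \<Longrightarrow> \<exists>N. \<forall>n\<ge>N. (f \<alpha> n, f \<beta> n) \<in> r (Suc n) - Id"
  proof (rule eventually_increasing_family[of \<kappa> B "\<lambda>n. r (Suc n)"])
    show "Well_order \<kappa>"
      using ck by (simp add: card_order_on_def)
    show "|underS \<kappa> \<alpha>| \<le>o |\<Union>n. B n|" for \<alpha>
    proof (cases "\<alpha> \<in> Field \<kappa>")
      case True
      \<comment> \<open>Proper initial segments of \<kappa>, the successor of \<open>s\<close>, have
        size at most \<open>s\<close>, which is the size of the union of the
        \<open>B n\<close>.\<close>
      have "|underS \<kappa> \<alpha>| <o \<kappa>"
        using card_of_underS[OF ck True] .
      then have "|underS \<kappa> \<alpha>| <o cardSuc s"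
        using ks by (rule ordLess_ordIso_trans)
      then have "|underS \<kappa> \<alpha>| \<le>o s"
        by (rule iffD1[OF cardSuc_ordLeq_ordLess[OF cs card_of_Card_order]])
      then show ?thesis
        unfolding B(3) using ordIso_symmetric[OF card_of_Field_ordIso[OF cs]] by (rule ordLeq_ordIso_trans)
    next
      case False
      then have "underS \<kappa> \<alpha> = {}"
        by (auto simp: underS_def Field_def)
      then show ?thesis
        by (simp add: card_of_empty)
    qed
    show "Cinfinite (r (Suc n))" "regularCard (r (Suc n))" for n
      using is_c_plus_Cinfinite[OF r(1)] is_c_plus_Suc_regularCard[OF r(1)] by blast+
    show "|B n| <o r (Suc n)" for n
      using B(1) is_c_plus_less_Suc[OF r(1) r(1)] by (rule ordIso_ordLess_trans)
  qed (use B(2) in auto)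

  have total: "(\<alpha>, \<beta>) \<in> \<kappa> - Id \<or> (\<beta>, \<alpha>) \<in> \<kappa> - Id" 
    if "\<alpha> \<in> Field \<kappa>" "\<beta> \<in> Field \<kappa>" "\<alpha> \<noteq> \<beta>" for \<alpha> \<beta>
    using ck that wo_rel.TOTALS[of \<kappa>] by (auto simp: card_order_on_def wo_rel_def)
  \<comment> \<open>The strict order of \<open>r (Suc n)\<close>, moved to the \<open>Inl\<close>
    part where the branches live.\<close>
  define S where "S n = {(Inl a :: 'a + bool, Inl b :: 'a + bool) | a b. (a, b) \<in> r (Suc n) - Id}" for n
  have S_asym: "(b, a) \<notin> S n" if "(a, b) \<in> S n" for a b n
    using that wo_rel.ANTISYM[of "r (Suc n)"] is_c_plus_Card_order[OF r(1), of "Suc n"]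
    by (auto simp: S_def card_order_on_def wo_rel_def antisym_def)
  have S_inc: "\<exists>N. \<forall>n\<ge>N. ((Inl \<circ> f \<alpha>) n, (Inl \<circ> f \<beta>) n) \<in> S n" if "(\<alpha>, \<beta>) \<in> \<kappa> - Id" for \<alpha> \<beta>
    using f_inc[OF that] by (auto simp: S_def)

  define Z where "Z = (\<lambda>\<alpha>. (Inl \<circ> f \<alpha> :: nat \<Rightarrow> 'a + bool)) ` Field \<kappa>"
  define T where "T = (\<Union>\<alpha>\<in>Field \<kappa>. range (cantor_branch (f \<alpha>)))"
  define X where "X = subtopology sequence_space T"
  have top: "topspace X = T"
    by (simp add: X_def)
  have sub: "subtopology X C = subtopology sequence_space C" if "C \<subseteq> T" for C
    using that by (simp add: X_def subtopology_subtopology inf_absorb2)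
  have ZT: "Z \<subseteq> T"
    unfolding Z_def T_def cantor_branch_all_True[symmetric] by auto

  have "|T| =o \<kappa>"
  proof -
    \<comment> \<open>Upper bound: \<kappa> many Cantor sets, each of size at most \<kappa>. The
      lower bound counts the branches.\<close>
    have "|range (cantor_branch (f \<alpha>))| \<le>o \<kappa>" for \<alpha>
      by (rule ordLeq_transitive[OF card_of_image ordLeq_transitive[OF cs_le[unfolded c_def] ordLess_imp_ordLeq[OF sk]]])
    then have "|T| \<le>o \<kappa>"
      unfolding T_def using \<open>infinite (Field \<kappa>)\<close> ck ordIso_imp_ordLeq[OF card_of_Field_ordIso[OF ck]]
      by (intro card_of_UNION_ordLeq_infinite_Field) auto
    moreover have "|Field \<kappa>| \<le>o |T|"
    proof (rule card_of_ordLeqI)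
      \<comment> \<open>Distinct indices are comparable in \<kappa>, so equal branches would have an
        entry related to itself by \<open>S n\<close>.\<close>
      show "inj_on (\<lambda>\<alpha>. (Inl \<circ> f \<alpha> :: nat \<Rightarrow> 'a + bool)) (Field \<kappa>)"
      proof (rule inj_onI, rule ccontr)
        fix \<alpha> \<beta> assume "\<alpha> \<in> Field \<kappa>" "\<beta> \<in> Field \<kappa>" "\<alpha> \<noteq> \<beta>"
          and eq: "(Inl \<circ> f \<alpha> :: nat \<Rightarrow> 'a + bool) = Inl \<circ> f \<beta>"
        then obtain n where "((Inl \<circ> f \<alpha>) n, (Inl \<circ> f \<alpha>) n) \<in> S n"
          using total[of \<alpha> \<beta>] S_inc[of \<alpha> \<beta>] S_inc[of \<beta> \<alpha>] by (metis order_refl)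
        then show False
          using S_asym by blast
      qed
    qed (use ZT in \<open>auto simp: Z_def\<close>)
    ultimately show ?thesis
      using card_of_Field_ordIso[OF ck] ordIso_iff_ordLeq ordIso_ordLeq_trans ordIso_symmetric by blast
  qed

  have "cantor_coverable X"
    unfolding cantor_coverable_def
  proof (intro exI[of _ "(\<lambda>\<alpha>. range (cantor_branch (f \<alpha>))) ` Field \<kappa>"] conjI ballI)
    fix C assume "C \<in> (\<lambda>\<alpha>. range (cantor_branch (f \<alpha>))) ` Field \<kappa>"
    then obtain \<alpha> where "\<alpha> \<in> Field \<kappa>" "C = range (cantor_branch (f \<alpha>))"
      by blast
    moreover from this have "C \<subseteq> T"
      by (auto simp: T_def)
    ultimately show "subtopology X C homeomorphic_space cantor_space"
      using sub cantor_branch_image_homeomorphic by metis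
  qed (simp only: top T_def)

  have "\<not> cantor_partitionable X"
  proof
    assume "cantor_partitionable X"
    then obtain \<C> where un: "\<Union>\<C> = T" and disj: "disjoint \<C>"
      and hom: "\<And>C. C \<in> \<C> \<Longrightarrow> subtopology X C homeomorphic_space cantor_space"
      unfolding cantor_partitionable_def top by metis
    \<comment> \<open>\<open>F\<close> collects all possible stem entries; as a countable union of
      sets smaller than \<open>s\<close> it has size at most \<open>s\<close>. Then \<open>Y\<close>
      contains every point of \<open>T\<close> off the branches and also has size at most
      \<open>s\<close>.\<close>
    define F where "F = (\<Union>n. Field (r (Suc n)))"
    define Y where "Y = (\<Union>n. stem_sequences F n)"
    have nat_le: "|UNIV :: nat set| \<le>o s"
      using inf_s infinite_iff_card_of_nat[of "Field s"] card_of_Field_ordIso[OF cs] ordLeq_ordIso_trans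
      by blast
    have "|F| \<le>o s"
      unfolding F_def
    proof (intro card_of_UNION_ordLeq_infinite_Field inf_s cs nat_le ballI)
      show "|Field (r (Suc n))| \<le>o s" for n
        using card_of_Field_ordIso[OF is_c_plus_Card_order[OF r(1)]] r(2)
          ordIso_ordLess_trans ordLess_imp_ordLeq by blast
    qed
    then have "|Y| \<le>o s"
      unfolding Y_def using cinf_s cs_le
      by (intro card_of_UNION_ordLeq_infinite_Field inf_s cs nat_le ballI card_of_stem_sequences)
        (simp_all add: c_def)
    have TY: "T \<subseteq> Y \<union> Z"
    proof
      fix x assume "x \<in> T"
      then obtain \<alpha> y where x: "\<alpha> \<in> Field \<kappa>" "x = cantor_branch (f \<alpha>) y"
        by (auto simp: T_def)
      show "x \<in> Y \<union> Z"
      proof (cases "y = (\<lambda>_. True)")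
        case True
        then show ?thesis
          using x by (auto simp: Z_def cantor_branch_all_True)
      next
        case False
        have "range (f \<alpha>) \<subseteq> F"
          using f by (auto simp: F_def)
        then show ?thesis
          using cantor_branch_in_stem_sequences[OF _ False] x(2) by (auto simp: Y_def)
      qed
    qed
    have "wf (\<kappa> - Id)"
      using ck by (simp add: card_order_on_def well_order_on_def)
    \<comment> \<open>A member missing \<open>Y\<close> would be a Cantor set made of branches only,
      which the increasing order of the family excludes.\<close>
    have "C \<inter> Y \<noteq> {}" if C: "C \<in> \<C>" for C
    proof
      assume "C \<inter> Y = {}"
      have "C \<subseteq> Z"
        using TY un C \<open>C \<inter> Y = {}\<close> by blast
      have "\<not> subtopology sequence_space C homeomorphic_space cantor_space"
      proof (rule no_cantor_set_in_increasing_family[where R = "\<kappa> - Id" and S = S])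
        show "C \<subseteq> (\<lambda>\<alpha>. Inl \<circ> f \<alpha>) ` Field \<kappa>"
          using \<open>C \<subseteq> Z\<close> unfolding Z_def .
        show "wf (\<kappa> - Id)"
          by fact
        show "(\<alpha>, \<beta>) \<in> \<kappa> - Id \<or> (\<beta>, \<alpha>) \<in> \<kappa> - Id"
          if "\<alpha> \<in> Field \<kappa>" "\<beta> \<in> Field \<kappa>" "\<alpha> \<noteq> \<beta>" for \<alpha> \<beta>
          using that by (rule total)
        show "\<exists>N. \<forall>n\<ge>N. ((Inl \<circ> f \<alpha>) n, (Inl \<circ> f \<beta>) n) \<in> S n" if "(\<alpha>, \<beta>) \<in> \<kappa> - Id" for \<alpha> \<beta>
          using that by (rule S_inc)
        show "(b, a) \<notin> S n" if "(a, b) \<in> S n" for a b n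
          using that by (rule S_asym)
      qed
      moreover have "C \<subseteq> T"
        using un C by blast
      ultimately show False
        using hom[OF C] sub by metis
    qed
    \<comment> \<open>Disjointness enters here: distinct members have distinct chosen points in
      \<open>Y\<close>.\<close>
    then have "|\<C>| \<le>o s"
      using disjoint_choice_card_of[OF disj] \<open>|Y| \<le>o s\<close> ordLeq_transitive by blast
    moreover have "|C| \<le>o s" if "C \<in> \<C>" for C
    proof -
      have "C \<subseteq> topspace X"
        using that un top by blast
      from card_of_homeomorphic_cantor[OF hom[OF that] this]
      have "|C| =o c"
        unfolding c_def using card_of_cantor ordIso_transitive ordIso_symmetric by blast
      then show ?thesis
        using cs_le by (rule ordIso_ordLeq_trans)
    qed
    \<comment> \<open>At most \<open>s\<close> many sets of size at most \<open>s\<close> have a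
      union of size at most \<open>s\<close>, too small for \<open>T\<close>.\<close>
    ultimately have "|\<Union>C\<in>\<C>. C| \<le>o s"
      by (intro card_of_UNION_ordLeq_infinite_Field inf_s cs) auto
    then have "|T| \<le>o s"
      by (simp add: un)
    with ordIso_symmetric[OF \<open>|T| =o \<kappa>\<close>] have "\<kappa> \<le>o s"
      by (rule ordIso_ordLeq_trans)
    then show False
      using sk not_ordLess_ordLeq by blast
  qed

  \<comment> \<open>\<open>X\<close> lives on sequences, so it is moved to
    \<open>Field \<kappa>\<close>, a set of the right size inside \<open>'a\<close>.\<close>
  have "|topspace X| =o |Field \<kappa>|"
    unfolding top using \<open>|T| =o \<kappa>\<close> ordIso_symmetric[OF card_of_Field_ordIso[OF ck]]
    by (rule ordIso_transitive)
  then obtain X' :: "'a topology" where X': "topspace X' = Field \<kappa>" "X' homeomorphic_space X"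
    by (rule homeomorphic_copy_on_set)
  have "metrizable_space X'"
    using homeomorphic_metrizable_space[OF X'(2)]
      metrizable_space_subtopology[OF metrizable_sequence_space] X_def by blast
  moreover have "|topspace X'| =o \<kappa>"
    unfolding X'(1) using ck by (rule card_of_Field_ordIso)
  moreover have "cantor_coverable X'"
    using homeomorphic_imp_cantor_coverable \<open>cantor_coverable X\<close> X'(2) homeomorphic_space_sym by blast
  moreover have "\<not> cantor_partitionable X'"
    using homeomorphic_imp_cantor_partitionable \<open>\<not> cantor_partitionable X\<close> X'(2) by blast
  ultimately show ?thesis
    by blast
qed

end
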